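(* For every $t\ge1$ there is a one-decision subtree (a single decision at date $t$, $T=t+1$) satisfying the finite-tree and bounded-reward assumptions for which $\mathfrak S_t(h_t)$ contains the open rectangle $$\left(\tfrac12,\tfrac34\right)\times\left(-\tfrac14,\tfrac14\right)^{t+1}\subset\mathbb R^{t+2}$$ and also the closed rectangle $[1/2,3/4]\times[-1/4,1/4]^{t+1}$. In particular it contains the closed cube $$Q_t:=\left(\tfrac58,0,\ldots,0\right)+\left[-\tfrac18,\tfrac18\right]^{t+2}.$$ Let $E:Q_t\to\mathbb R^d$ be any continuous state encoder and let $D:\mathbb R^d\to\mathbb R^{t+2}$ be any decoder, not necessarily continuous. If $d<t+2$, then $$\sup_{x\in Q_t}\|D(E(x))-x\|_\infty\ge\tfrac18 .$$ Consequently, exact recovery and every uniform approximation with error strictly below $1/8$ require $d\ge t+2$. If all reward bounds are multiplied by $c>0$, the lower bound becomes $c/8$ (for the scaled cube $cQ_t$, which is then contained in the scaled attainable set). Thus $\varepsilon$-sufficient continuous vintage memory has worst-case dimension $\Omega(t)$ even when only approximate value preservation is required.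
   Context: One-decision subtree at date $t$ with $T=t+1$: a history $h_t$, a finite nonempty action set $\mathcal A$, for each action $a$ a finite outcome set $\mathcal Y(a)$ (each pair $(a,y)$ a terminal history), discount $\beta\in(0,1]$, reward bounds $R_t,G\ge0$, and, for each evaluator vintage $s=0,\dots,t$ and action $a$, a nonempty compact set $\mathcal K_{s,t}(a)\subseteq\Delta(\mathcal Y(a))$ of one-step kernels. A bounded reward system consists of current rewards $c_a\in[-R_t,R_t]$ and terminal rewards $g(a,y)\in[-G,G]$. Vintage $s$'s value of action $a$ is $U_{s,a}=c_a+\beta\inf_{q\in\mathcal K_{s,t}(a)}\sum_yq(y)g(a,y)$. The attainable set is $$\mathfrak S_t(h_t)=\Bigl\{\bigl(\max_aU_{0,a};\,U_{0,a_F},U_{1,a_F},\ldots,U_{t,a_F}\bigr):\ (c,g)\text{ a bounded reward system},\ a_F\in\arg\max_aU_{t,a}\Bigr\}\subseteq\mathbb R^{t+2},$$ i.e. all vectors consisting of the vintage-$0$ precommitment value followed by all vintages' valuations of an action optimal for the current (vintage-$t$) self. *)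

theory Defs
  imports "HOL-Analysis.Analysis" "HOL-Library.Landau_Symbols"
begin

(* The space R^n is the library's Euclidean_space n, whose points are the functions
   nat => real vanishing at every index i >= n; coordinates are numbered from 0. *)

section \<open>One-decision subtrees\<close>

(* The history at which the decision is taken is the root of the subtree. A terminal history
   is a pair of an action and an outcome. The kernel set of vintage s at action a consists of
   functions on the whole outcome type that vanish outside the outcome set of a. *)
record ('a, 'y) subtree =
  date :: nat
  actions :: "'a set"
  outcomes :: "'a \<Rightarrow> 'y set"
  discount :: real
  current_bound :: real
  terminal_bound :: real
  kernels :: "nat \<Rightarrow> 'a \<Rightarrow> ('y \<Rightarrow> real) set"

definition prob_simplex :: "'y set \<Rightarrow> ('y \<Rightarrow> real) set" where
  "prob_simplex Y = {q. (\<forall>y\<in>Y. 0 \<le> q y) \<and> (\<forall>y. y \<notin> Y \<longrightarrow> q y = 0) \<and> (\<Sum>y\<in>Y. q y) = 1}"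

(* Compactness refers to the product topology on functions, which on the functions supported
   in a fixed finite set Y is the Euclidean topology of R^Y. *)
definition one_decision_subtree :: "('a, 'y) subtree \<Rightarrow> bool" where
  "one_decision_subtree S \<longleftrightarrow>
     finite (actions S) \<and> actions S \<noteq> {} \<and>
     (\<forall>a\<in>actions S. finite (outcomes S a) \<and> outcomes S a \<noteq> {}) \<and>
     0 < discount S \<and> discount S \<le> 1 \<and>
     0 \<le> current_bound S \<and> 0 \<le> terminal_bound S \<and>
     (\<forall>s\<le>date S. \<forall>a\<in>actions S.
        kernels S s a \<noteq> {} \<and> compact (kernels S s a) \<and>
        kernels S s a \<subseteq> prob_simplex (outcomes S a))"

definition bounded_rewards ::
    "('a, 'y) subtree \<Rightarrow> ('a \<Rightarrow> real) \<Rightarrow> ('a \<Rightarrow> 'y \<Rightarrow> real) \<Rightarrow> bool" where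
  "bounded_rewards S c g \<longleftrightarrow>
     (\<forall>a\<in>actions S. c a \<in> {- current_bound S .. current_bound S}) \<and>
     (\<forall>a\<in>actions S. \<forall>y\<in>outcomes S a. g a y \<in> {- terminal_bound S .. terminal_bound S})"

definition vintage_value ::
    "('a, 'y) subtree \<Rightarrow> ('a \<Rightarrow> real) \<Rightarrow> ('a \<Rightarrow> 'y \<Rightarrow> real) \<Rightarrow> nat \<Rightarrow> 'a \<Rightarrow> real" where
  "vintage_value S c g s a =
     c a + discount S * (INF q\<in>kernels S s a. \<Sum>y\<in>outcomes S a. q y * g a y)"

definition value_vector ::
    "('a, 'y) subtree \<Rightarrow> ('a \<Rightarrow> real) \<Rightarrow> ('a \<Rightarrow> 'y \<Rightarrow> real) \<Rightarrow> 'a \<Rightarrow> nat \<Rightarrow> real" where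
  "value_vector S c g aF = (\<lambda>i.
     if i = 0 then Max (vintage_value S c g 0 ` actions S)
     else if i \<le> date S + 1 then vintage_value S c g (i - 1) aF
     else 0)"

definition attainable :: "('a, 'y) subtree \<Rightarrow> (nat \<Rightarrow> real) set" where
  "attainable S =
     {value_vector S c g aF | c g aF.
        bounded_rewards S c g \<and>
        is_arg_max (vintage_value S c g (date S)) (\<lambda>a. a \<in> actions S) aF}"

definition scale_bounds :: "real \<Rightarrow> ('a, 'y) subtree \<Rightarrow> ('a, 'y) subtree" where
  "scale_bounds r S =
     S\<lparr>current_bound := r * current_bound S, terminal_bound := r * terminal_bound S\<rparr>"


section \<open>Boxes in Euclidean space\<close>

definition rectangle :: "nat \<Rightarrow> (nat \<Rightarrow> real set) \<Rightarrow> (nat \<Rightarrow> real) set" where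
  "rectangle n I = {x \<in> topspace (Euclidean_space n). \<forall>i<n. x i \<in> I i}"

definition value_cube :: "nat \<Rightarrow> (nat \<Rightarrow> real) set" where
  "value_cube t =
     (\<lambda>v i. (if i = 0 then 5/8 else 0) + v i) ` rectangle (t + 2) (\<lambda>i. {-1/8..1/8})"

definition scale_set :: "real \<Rightarrow> (nat \<Rightarrow> real) set \<Rightarrow> (nat \<Rightarrow> real) set" where
  "scale_set r X = (\<lambda>x i. r * x i) ` X"


section \<open>Encoders, decoders and memory dimension\<close>

definition continuous_encoder ::
    "nat \<Rightarrow> (nat \<Rightarrow> real) set \<Rightarrow> nat \<Rightarrow> ((nat \<Rightarrow> real) \<Rightarrow> nat \<Rightarrow> real) \<Rightarrow> bool" where
  "continuous_encoder n X d E \<longleftrightarrow>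
     continuous_map (subtopology (Euclidean_space n) X) (Euclidean_space d) E"

definition decoder :: "nat \<Rightarrow> nat \<Rightarrow> ((nat \<Rightarrow> real) \<Rightarrow> nat \<Rightarrow> real) \<Rightarrow> bool" where
  "decoder d n D \<longleftrightarrow> D \<in> topspace (Euclidean_space d) \<rightarrow> topspace (Euclidean_space n)"

definition sup_dist :: "nat \<Rightarrow> (nat \<Rightarrow> real) \<Rightarrow> (nat \<Rightarrow> real) \<Rightarrow> real" where
  "sup_dist n x y = Max ((\<lambda>i. \<bar>x i - y i\<bar>) ` {..<n})"

(* Extended-real valued, since a discontinuous decoder can have unbounded error. *)
definition recovery_error ::
    "nat \<Rightarrow> (nat \<Rightarrow> real) set \<Rightarrow> ((nat \<Rightarrow> real) \<Rightarrow> nat \<Rightarrow> real) \<Rightarrow>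
     ((nat \<Rightarrow> real) \<Rightarrow> nat \<Rightarrow> real) \<Rightarrow> ereal" where
  "recovery_error n X E D = (SUP x\<in>X. ereal (sup_dist n (D (E x)) x))"

definition sufficient_memory :: "real \<Rightarrow> nat \<Rightarrow> (nat \<Rightarrow> real) set \<Rightarrow> nat \<Rightarrow> bool" where
  "sufficient_memory \<epsilon> n X d \<longleftrightarrow>
     (\<exists>E D. continuous_encoder n X d E \<and> decoder d n D \<and> recovery_error n X E D \<le> ereal \<epsilon>)"

(* For \<epsilon> >= 0 and X inside R^n the identity shows that d = n is sufficient. *)
definition memory_dim :: "real \<Rightarrow> nat \<Rightarrow> (nat \<Rightarrow> real) set \<Rightarrow> nat" where
  "memory_dim \<epsilon> n X = (LEAST d. sufficient_memory \<epsilon> n X d)"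

(* The reward bounds R and G are held fixed because an absolute error \<epsilon> is meaningful only
   relative to them. For \<epsilon> >= 0 the supremum is over numbers that are at most t + 2. Using nat
   for actions and outcomes is no restriction, as both range over finite sets. *)
definition worst_case_dim :: "real \<Rightarrow> real \<Rightarrow> real \<Rightarrow> nat \<Rightarrow> nat" where
  "worst_case_dim \<epsilon> R G t =
     (SUP S \<in> {S :: (nat, nat) subtree. one_decision_subtree S \<and> date S = t \<and>
                 current_bound S = R \<and> terminal_bound S = G}.
        memory_dim \<epsilon> (t + 2) (attainable S))"

end

theory Submission
  imports Defs
begin

text \<open>
  Two independent facts combine. The first is an example: with one outcome per vintage, and every
  vintage certain of its own outcome, the terminal rewards of the chosen action realise any vector of
  vintage values within the reward bounds, while a second action, attractive to vintage 0 only,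
  realises any larger precommitment value within them. The attainable set then has full dimension
  \<open>t + 2\<close> (\<open>attainable_vintage_tree\<close>), and multiplying all reward bounds by a constant scales the picture.

  The second is a rigidity of boxes: a continuous map from an \<open>n\<close>-dimensional box to \<open>\<real>\<^sup>d\<close> with \<open>d < n\<close>
  takes the same value at two points on opposite faces
  (\<open>continuous_map_identifies_opposite_faces\<close>). Any decoder then errs by at least half the
  width of the box at one of the two points. The cube of half-width \<open>1/8\<close> inside the attainable set
  gives the constant of the theorem, and an encoder for the whole attainable set restricts to one for
  the cube, so that every tolerance below \<open>1/8\<close> needs all \<open>t + 2\<close> dimensions.

  Rigidity follows from the theorem of Poincare and Miranda, the form of Brouwer's fixed point
  theorem suited to boxes, together with the fact that a Lipschitz map from a bounded part of \<open>\<real>\<^sup>d\<close>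
  cannot cover a cube in \<open>\<real>\<^sup>n\<close>. If the images of opposite faces were disjoint, the signed differences
  of the distances to them would be such a Lipschitz map, and yet Poincare--Miranda, applied to its
  composition with the encoder, would make it cover a cube.
\<close>

section \<open>Zeros of vector fields on boxes\<close>

abbreviation box_of :: "nat \<Rightarrow> (nat \<Rightarrow> real) \<Rightarrow> (nat \<Rightarrow> real) \<Rightarrow> (nat \<Rightarrow> real) set" where
  "box_of n a b \<equiv> rectangle n (\<lambda>i. {a i..b i})"

lemma compact_box: "compact (box_of n a b)"
proof -
  have "compactin (product_topology (\<lambda>i. euclidean) UNIV)
          (PiE UNIV (\<lambda>i. if i < n then {a i..b i} else {0::real}))"
    by (subst compactin_PiE) auto
  moreover have "PiE UNIV (\<lambda>i. if i < n then {a i..b i} else {0::real}) = box_of n a b"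
    by (auto simp: rectangle_def topspace_Euclidean_space PiE_def Pi_iff split: if_splits)
  ultimately show ?thesis
    by (simp add: euclidean_product_topology)
qed

text \<open>The metric on functions weights the coordinates by a geometric series of sum 2. It therefore
  never exceeds twice the maximum distance, so that grid estimates made coordinate by coordinate
  apply to it.\<close>
lemma dist_fun_le_coordinatewise:
  fixes x y :: "'a::countable \<Rightarrow> real"
  assumes "\<And>i. \<bar>x i - y i\<bar> \<le> e"
  shows "dist x y \<le> 2 * e"
proof -
  have le: "2 * Max {dist (x (from_nat n)) (y (from_nat n)) |n. n \<le> N} \<le> 2 * e" for N
    using assms by (subst mult_le_cancel_left_pos, simp, subst Max_le_iff) (auto simp: dist_real_def)
  have "dist x y \<le> 2 * e + (1/2)^N" for N :: nat
    using dist_fun_le_dist_first_terms[of x y N] le[of N] by linarith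
  moreover have "(\<lambda>N. 2 * e + (1/2)^N) \<longlonglongrightarrow> 2 * e + (0::real)"
    by (intro tendsto_intros LIMSEQ_realpow_zero) auto
  ultimately show ?thesis
    by (intro LIMSEQ_le_const[where X = "\<lambda>N. 2 * e + (1/2)^N" and a = "dist x y"]) auto
qed

lemma finitely_many_uniformly_continuous:
  fixes f :: "nat \<Rightarrow> 'a::metric_space \<Rightarrow> real"
  assumes "compact X" "\<And>i. i < n \<Longrightarrow> continuous_on X (f i)" "0 < e"
  shows "\<exists>\<delta>>0. \<forall>i<n. \<forall>x\<in>X. \<forall>y\<in>X. dist x y < \<delta> \<longrightarrow> \<bar>f i x - f i y\<bar> < e"
proof -
  have "\<exists>\<delta>>0. \<forall>x\<in>X. \<forall>y\<in>X. dist x y < \<delta> \<longrightarrow> \<bar>f i x - f i y\<bar> < e" if "i < n" for i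
    using compact_uniformly_continuous[OF assms(2)[OF that] assms(1)] \<open>0 < e\<close>
    unfolding uniformly_continuous_on_def dist_real_def by metis
  then obtain D where D: "\<And>i. i < n \<Longrightarrow> D i > 0"
      "\<And>i x y. i < n \<Longrightarrow> x \<in> X \<Longrightarrow> y \<in> X \<Longrightarrow> dist x y < D i \<Longrightarrow> \<bar>f i x - f i y\<bar> < e"
    by metis
  define \<delta> where "\<delta> = Min (insert 1 (D ` {..<n}))"
  have "0 < \<delta>" "\<And>i. i < n \<Longrightarrow> \<delta> \<le> D i"
    using D(1) by (auto simp: \<delta>_def)
  then show ?thesis
    using D(2) by (meson less_le_trans)
qed

text \<open>Label the points of a fine grid in the box by the signs of the \<open>f i\<close>. Kuhn's combinatorial
  lemma yields one small grid cell in which every \<open>f i\<close> takes both signs, so that by uniform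
  continuity all of them are small there. The lemma is indexed by a natural number, and so the
  dimension of the box can be a term.\<close>
lemma approximate_poincare_miranda:
  fixes f :: "nat \<Rightarrow> (nat \<Rightarrow> real) \<Rightarrow> real"
  assumes ab: "\<And>i. i < n \<Longrightarrow> a i \<le> b i"
    and cont: "\<And>i. i < n \<Longrightarrow> continuous_on (box_of n a b) (f i)"
    and lo: "\<And>i x. i < n \<Longrightarrow> x \<in> box_of n a b \<Longrightarrow> x i = a i \<Longrightarrow> f i x \<le> 0"
    and hi: "\<And>i x. i < n \<Longrightarrow> x \<in> box_of n a b \<Longrightarrow> x i = b i \<Longrightarrow> 0 \<le> f i x"
    and "0 < e"
  shows "\<exists>x\<in>box_of n a b. \<forall>i<n. \<bar>f i x\<bar> < e"
proof -
  obtain \<delta> where \<delta>: "0 < \<delta>"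
    "\<And>i x y. i < n \<Longrightarrow> x \<in> box_of n a b \<Longrightarrow> y \<in> box_of n a b \<Longrightarrow> dist x y < \<delta> \<Longrightarrow> \<bar>f i x - f i y\<bar> < e"
    using finitely_many_uniformly_continuous[of "box_of n a b" n f e, OF compact_box cont \<open>0 < e\<close>]
    by blast
  define W where "W = (\<Sum>i<n. b i - a i)"
  have W: "b i - a i \<le> W" if "i < n" for i
    unfolding W_def using that ab by (intro member_le_sum) auto
  have "0 \<le> W"
    unfolding W_def using ab by (intro sum_nonneg) auto
  obtain p :: nat where p: "2 * W / \<delta> < real p"
    using reals_Archimedean2 by blast
  with \<open>0 \<le> W\<close> \<delta>(1) have "0 < p"
    by (cases p) (auto simp: field_simps)
  have mesh: "2 * (W / p) < \<delta>"
    using p \<open>0 < p\<close> \<delta>(1) by (simp add: field_simps)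
  define pt where "pt k = (\<lambda>i. if i < n then a i + (b i - a i) * (real (k i) / real p) else 0)"
    for k :: "nat \<Rightarrow> nat"
  have pt_box: "pt k \<in> box_of n a b" if "\<forall>i<n. k i \<le> p" for k
  proof -
    have "0 \<le> (b i - a i) * (real (k i) / real p)"
      "(b i - a i) * (real (k i) / real p) \<le> (b i - a i) * 1" if "i < n" for i
      using ab[OF that] \<open>\<forall>i<n. k i \<le> p\<close> that \<open>0 < p\<close>
      by (auto simp del: times_divide_eq_right intro!: mult_left_le mult_nonneg_nonneg)
    then show ?thesis
      unfolding rectangle_def topspace_Euclidean_space pt_def by fastforce
  qed
  have pt_near: "dist (pt k) (pt l) < \<delta>"
    if "\<forall>j<n. k j \<le> l j \<and> l j \<le> k j + 1" for k l
  proof -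
    have "\<bar>pt k i - pt l i\<bar> \<le> W / p" for i
    proof (cases "i < n")
      case True
      have "\<bar>real (k i) - real (l i)\<bar> \<le> 1"
        using that True by force
      then have "\<bar>(real (k i) - real (l i)) / real p\<bar> \<le> 1 / p"
        by (simp add: divide_right_mono)
      have "\<bar>pt k i - pt l i\<bar> = (b i - a i) * \<bar>(real (k i) - real (l i)) / real p\<bar>"
        using True ab[OF True]
        by (simp add: pt_def abs_mult diff_divide_distrib
            flip: right_diff_distrib times_divide_eq_right)
      also have "\<dots> \<le> W * (1 / p)"
        using W[OF True] \<open>0 \<le> W\<close> \<open>\<bar>(real (k i) - real (l i)) / real p\<bar> \<le> 1 / p\<close>
        by (intro mult_mono) auto
      finally show ?thesis by simp
    qed (use \<open>0 \<le> W\<close> in \<open>simp add: pt_def\<close>)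
    then have "dist (pt k) (pt l) \<le> 2 * (W / p)"
      by (rule dist_fun_le_coordinatewise)
    with mesh show ?thesis
      by linarith
  qed
  \<comment> \<open>On the faces the sign conditions allow \<open>f i = 0\<close>, while Kuhn's lemma prescribes the label, so
     there the label is fixed by hand. It remains true that label 0 implies \<open>f i \<le> 0\<close> and label 1
     implies \<open>f i \<ge> 0\<close>.\<close>
  define label where "label k i = (if k i = 0 \<or> (f i (pt k) < 0 \<and> k i \<noteq> p) then 0 else 1 :: nat)"
    for k i
  have label0: "f i (pt k) \<le> 0" if "label k i = 0" "i < n" "\<forall>i<n. k i \<le> p" for k i
    using that lo[of i "pt k"] pt_box[of k] by (auto simp: label_def pt_def split: if_splits)
  have label1: "0 \<le> f i (pt k)" if "label k i \<noteq> 0" "i < n" "\<forall>i<n. k i \<le> p" for k i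
    using that hi[of i "pt k"] pt_box[of k] \<open>0 < p\<close> by (auto simp: label_def pt_def split: if_splits)
  have labels: "\<forall>k. (\<forall>i<n. k i \<le> p) \<longrightarrow> (\<forall>i<n. label k i = 0 \<or> label k i = 1)"
    "\<forall>k. (\<forall>i<n. k i \<le> p) \<longrightarrow> (\<forall>i<n. k i = 0 \<longrightarrow> label k i = 0)"
    "\<forall>k. (\<forall>i<n. k i \<le> p) \<longrightarrow> (\<forall>i<n. k i = p \<longrightarrow> label k i = 1)"
    using \<open>0 < p\<close> by (auto simp: label_def)
  obtain q where q: "\<forall>i<n. q i < p"
    and cell: "\<forall>i<n. \<exists>r s. (\<forall>j<n. q j \<le> r j \<and> r j \<le> q j + 1) \<and>
      (\<forall>j<n. q j \<le> s j \<and> s j \<le> q j + 1) \<and> label r i \<noteq> label s i"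
    by (rule kuhn_lemma[OF \<open>0 < p\<close> labels])
  have "\<bar>f i (pt q)\<bar> < e" if i: "i < n" for i
  proof -
    obtain r s where rs: "\<forall>j<n. q j \<le> r j \<and> r j \<le> q j + 1"
      "\<forall>j<n. q j \<le> s j \<and> s j \<le> q j + 1" "label r i \<noteq> label s i"
      using mp[OF spec[OF cell] i] by blast
    have "q j \<le> p \<and> r j \<le> p \<and> s j \<le> p" if "j < n" for j
      using spec[OF q, of j] spec[OF rs(1), of j] spec[OF rs(2), of j] that by linarith
    then have grid: "\<forall>i<n. q i \<le> p" "\<forall>i<n. r i \<le> p" "\<forall>i<n. s i \<le> p"
      by simp_all
    have "\<bar>f i (pt q) - f i (pt r)\<bar> < e" "\<bar>f i (pt q) - f i (pt s)\<bar> < e"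
      using pt_near[OF rs(1)] pt_near[OF rs(2)]
      by (simp_all add: \<delta>(2)[OF i pt_box[OF grid(1)]] pt_box[OF grid(2)] pt_box[OF grid(3)])
    moreover have "label r i = 0 \<or> label s i = 0"
      using rs(3) by (auto simp: label_def split: if_splits)
    then have "f i (pt r) \<le> 0 \<and> 0 \<le> f i (pt s) \<or> f i (pt s) \<le> 0 \<and> 0 \<le> f i (pt r)"
      using label0[OF _ i grid(2)] label0[OF _ i grid(3)]
        label1[OF _ i grid(2)] label1[OF _ i grid(3)] rs(3) by metis
    ultimately show ?thesis by linarith
  qed
  moreover have "pt q \<in> box_of n a b"
    using q by (intro pt_box) (simp add: less_imp_le)
  ultimately show ?thesis by blast
qed

text \<open>The theorem of Poincare and Miranda. By compactness \<open>\<Sum>i<n. \<bar>f i x\<bar>\<close> attains its minimum,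
  and the approximate zeros leave no positive value for it.\<close>
theorem poincare_miranda:
  fixes f :: "nat \<Rightarrow> (nat \<Rightarrow> real) \<Rightarrow> real"
  assumes "\<And>i. i < n \<Longrightarrow> a i \<le> b i"
    and cont: "\<And>i. i < n \<Longrightarrow> continuous_on (box_of n a b) (f i)"
    and "\<And>i x. i < n \<Longrightarrow> x \<in> box_of n a b \<Longrightarrow> x i = a i \<Longrightarrow> f i x \<le> 0"
    and "\<And>i x. i < n \<Longrightarrow> x \<in> box_of n a b \<Longrightarrow> x i = b i \<Longrightarrow> 0 \<le> f i x"
  shows "\<exists>x\<in>box_of n a b. \<forall>i<n. f i x = 0"
proof -
  have approx: "\<exists>x\<in>box_of n a b. \<forall>i<n. \<bar>f i x\<bar> < e" if "0 < e" for e
    by (rule approximate_poincare_miranda) (use assms that in auto)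
  define F where "F x = (\<Sum>i<n. \<bar>f i x\<bar>)" for x
  have contF: "continuous_on (box_of n a b) F"
    unfolding F_def using cont by (auto intro!: continuous_intros)
  have "box_of n a b \<noteq> {}"
    using approx[OF zero_less_one] by auto
  then obtain x where x: "x \<in> box_of n a b" "\<And>y. y \<in> box_of n a b \<Longrightarrow> F x \<le> F y"
    using continuous_attains_inf[OF compact_box _ contF] by blast
  have "F x \<le> 0"
  proof (rule ccontr)
    assume "\<not> F x \<le> 0"
    then have pos: "0 < F x / (n + 1)" by (simp add: divide_pos_pos)
    then obtain y where y: "y \<in> box_of n a b" "\<And>i. i < n \<Longrightarrow> \<bar>f i y\<bar> < F x / (n + 1)"
      using approx by blast
    have "F y \<le> real n * (F x / (n + 1))"
      unfolding F_def[of y] using sum_bounded_above[of "{..<n}" "\<lambda>i. \<bar>f i y\<bar>" "F x / (n + 1)"] y(2)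
      by (auto intro: less_imp_le)
    also have "\<dots> < F x"
      using pos by (simp add: field_simps)
    finally show False
      using x(2)[OF y(1)] by simp
  qed
  then have "F x = 0"
    unfolding F_def by (smt (verit) sum_nonneg abs_ge_zero)
  then show ?thesis
    using x(1) by (auto simp: F_def sum_nonneg_eq_0_iff)
qed

section \<open>Continuous maps into a space of lower dimension\<close>

text \<open>A Lipschitz map does not raise dimension, by counting. If every point of the cube of
  half-width \<open>\<delta>\<close> were attained, choose preimages of the \<open>(m + 1) ^ n\<close> points of a grid of mesh
  \<open>2 * \<delta> / m\<close>. The Lipschitz bound keeps different preimages out of a common cell of side \<open>\<eta>\<close>,
  where \<open>\<eta>\<close> is proportional to \<open>1 / m\<close>, and at most a constant times \<open>m ^ d\<close> such cells
  meet \<open>K\<close>. As \<open>d < n\<close>, this fails for large \<open>m\<close>.\<close>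
lemma lipschitz_image_omits_point_of_cube:
  fixes h :: "nat \<Rightarrow> (nat \<Rightarrow> real) \<Rightarrow> real"
  assumes K: "K \<subseteq> topspace (Euclidean_space d)"
    and bound: "\<And>z j. z \<in> K \<Longrightarrow> j < d \<Longrightarrow> \<bar>z j\<bar> \<le> M"
    and lip: "\<And>z w i. z \<in> K \<Longrightarrow> w \<in> K \<Longrightarrow> i < n \<Longrightarrow> \<bar>h i z - h i w\<bar> \<le> L * dist z w"
    and "0 < L" "0 < \<delta>" "d < n"
  shows "\<exists>v. (\<forall>i<n. \<bar>v i\<bar> \<le> \<delta>) \<and> (\<forall>z\<in>K. \<exists>i<n. h i z \<noteq> v i)"
proof (rule ccontr)
  assume "\<not> ?thesis"
  then have surj: "\<exists>z\<in>K. \<forall>i<n. h i z = v i" if "\<forall>i<n. \<bar>v i\<bar> \<le> \<delta>" for v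
    using that by blast
  obtain B0 :: nat where B0: "2 * L * M / \<delta> < real B0"
    using reals_Archimedean2 by blast
  define B where "B = B0 + 1"
  \<comment> \<open>The count below gives \<open>m ^ (d + 1) \<le> (3 * B * m) ^ d\<close>, which this \<open>m\<close> just violates.\<close>
  define m where "m = (3 * B) ^ d + 1"
  have "0 < B" "0 < m" by (auto simp: B_def m_def)
  \<comment> \<open>Two points of one cell are at distance at most \<open>2 * \<eta>\<close>, so their images differ by at most
     \<open>2 * L * \<eta> = \<delta> / m\<close> in each coordinate, which is half the mesh of the grid.\<close>
  define \<eta> where "\<eta> = \<delta> / (2 * L * m)"
  have "0 < \<eta>"
    using \<open>0 < L\<close> \<open>0 < \<delta>\<close> \<open>0 < m\<close> by (simp add: \<eta>_def)
  define v where "v k = (\<lambda>i. - \<delta> + 2 * \<delta> * (real (k i) / real m))" for k :: "nat \<Rightarrow> nat"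
  define G where "G = ({..<n} \<rightarrow>\<^sub>E {0..m})"
  have "\<exists>z\<in>K. \<forall>i<n. h i z = v k i" if "k \<in> G" for k
  proof (rule surj, intro allI impI)
    fix i assume "i < n"
    then have "k i \<le> m"
      using that by (auto simp: G_def PiE_iff)
    then have "0 \<le> 2 * \<delta> * (real (k i) / real m)" "2 * \<delta> * (real (k i) / real m) \<le> 2 * \<delta> * 1"
      using \<open>0 < \<delta>\<close> \<open>0 < m\<close> by (simp, intro mult_left_mono) auto
    then show "\<bar>v k i\<bar> \<le> \<delta>"
      unfolding v_def by (simp add: abs_le_iff)
  qed
  then obtain Z where Z: "\<And>k. k \<in> G \<Longrightarrow> Z k \<in> K" "\<And>k i. k \<in> G \<Longrightarrow> i < n \<Longrightarrow> h i (Z k) = v k i"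
    by metis
  define cell where "cell z = (\<lambda>j\<in>{..<d}. \<lfloor>z j / \<eta>\<rfloor>)" for z :: "nat \<Rightarrow> real"
  define C where "C = ({..<d} \<rightarrow>\<^sub>E {- int (m * B)..int (m * B)})"
  have cell_C: "cell z \<in> C" if "z \<in> K" for z
  proof -
    have "- int (m * B) \<le> \<lfloor>z j / \<eta>\<rfloor> \<and> \<lfloor>z j / \<eta>\<rfloor> \<le> int (m * B)" if "j < d" for j
    proof -
      have "\<bar>z j / \<eta>\<bar> \<le> M / \<eta>"
        using bound[OF \<open>z \<in> K\<close> \<open>j < d\<close>] \<open>0 < \<eta>\<close> by (simp add: divide_right_mono)
      also have "\<dots> = m * (2 * L * M / \<delta>)"
        by (simp add: \<eta>_def)
      also have "\<dots> \<le> m * real B"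
        using B0 by (intro mult_left_mono) (auto simp: B_def)
      finally have "\<bar>z j / \<eta>\<bar> \<le> real_of_int (int (m * B))"
        by simp
      then show ?thesis
        unfolding abs_le_iff by linarith
    qed
    then show ?thesis
      unfolding cell_def C_def by auto
  qed
  have "inj_on (\<lambda>k. cell (Z k)) G"
  proof (rule inj_onI)
    fix k l assume k: "k \<in> G" and l: "l \<in> G" and eq: "cell (Z k) = cell (Z l)"
    have "\<bar>Z k j - Z l j\<bar> \<le> \<eta>" for j
    proof (cases "j < d")
      case True
      then have "\<lfloor>Z k j / \<eta>\<rfloor> = \<lfloor>Z l j / \<eta>\<rfloor>"
        using eq unfolding cell_def by (metis lessThan_iff restrict_apply')
      then have "\<bar>Z k j / \<eta> - Z l j / \<eta>\<bar> \<le> 1"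
        by linarith
      then have "\<bar>Z k j - Z l j\<bar> / \<eta> \<le> 1"
        using \<open>0 < \<eta>\<close> by (simp flip: diff_divide_distrib)
      then show ?thesis
        using \<open>0 < \<eta>\<close> by simp
    next
      case False
      then have "Z k j = 0" "Z l j = 0"
        using Z(1)[OF k] Z(1)[OF l] K by (auto simp: topspace_Euclidean_space)
      then show ?thesis
        using \<open>0 < \<eta>\<close> by simp
    qed
    then have near: "dist (Z k) (Z l) \<le> 2 * \<eta>"
      by (rule dist_fun_le_coordinatewise)
    have "k i = l i" if "i < n" for i
    proof -
      have "2 * \<delta> * \<bar>real (k i) - real (l i)\<bar> / m = \<bar>h i (Z k) - h i (Z l)\<bar>"
        using Z(2) k l that \<open>0 < \<delta>\<close>
        by (simp add: v_def abs_mult flip: right_diff_distrib diff_divide_distrib)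
      also have "\<dots> \<le> L * (2 * \<eta>)"
        using lip[OF Z(1)[OF k] Z(1)[OF l] that] near \<open>0 < L\<close>
        by (meson mult_left_mono less_imp_le order_trans)
      also have "\<dots> = \<delta> / m"
        using \<open>0 < L\<close> by (simp add: \<eta>_def)
      finally have "2 * \<bar>real (k i) - real (l i)\<bar> \<le> 1"
        using \<open>0 < \<delta>\<close> \<open>0 < m\<close> by (simp add: field_simps)
      then show ?thesis
        by (cases "k i" "l i" rule: linorder_cases) (auto dest!: less_imp_Suc_add)
    qed
    then show "k = l"
      using k l unfolding G_def by (metis PiE_ext lessThan_iff)
  qed
  moreover have "(\<lambda>k. cell (Z k)) ` G \<subseteq> C"
    using Z(1) cell_C by auto
  moreover have "finite C"
    unfolding C_def by (simp add: finite_PiE)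
  ultimately have "card G \<le> card C"
    by (rule card_inj_on_le)
  then have "(m + 1) ^ n \<le> (2 * (m * B) + 1) ^ d"
    by (simp add: G_def C_def card_PiE nat_add_distrib nat_mult_distrib algebra_simps)
  moreover have "m ^ Suc d \<le> (m + 1) ^ n"
    using \<open>d < n\<close> \<open>0 < m\<close> by (intro order_trans[OF power_mono[of m "m + 1"] power_increasing]) auto
  moreover have "(2 * (m * B) + 1) ^ d \<le> (m * (3 * B)) ^ d"
    using \<open>0 < B\<close> \<open>0 < m\<close> by (intro power_mono) (auto simp: Suc_le_eq)
  ultimately have "m ^ Suc d \<le> (m * (3 * B)) ^ d"
    by linarith
  then have "m ^ d * m \<le> m ^ d * (3 * B) ^ d"
    unfolding power_Suc2 power_mult_distrib .
  then have "m \<le> (3 * B) ^ d"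
    using \<open>0 < m\<close> by (metis mult_le_cancel1 zero_less_power)
  then show False
    by (simp add: m_def)
qed

text \<open>This is the topological core, a form of Lebesgue's covering theorem. If \<open>E\<close> separated all pairs
  of opposite faces, the functions \<open>h i\<close>, each the difference of the distances to the images of the
  two faces of index \<open>i\<close>, would have opposite signs on these images, bounded away from 0. By
  Poincare--Miranda the composition of \<open>h\<close> with \<open>E\<close> would then cover a cube of dimension \<open>n\<close>. But \<open>h\<close> is
  Lipschitz on a bounded subset of a space of dimension \<open>d < n\<close>. Inserting the Lipschitz map \<open>h\<close> is
  what makes an argument by counting available for an \<open>E\<close> that is merely continuous.\<close>
theorem continuous_map_identifies_opposite_faces:
  assumes ab: "\<And>i. i < n \<Longrightarrow> a i \<le> b i"
    and E: "continuous_encoder n (box_of n a b) d E" and "d < n"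
  shows "\<exists>i<n. \<exists>x\<in>box_of n a b. \<exists>y\<in>box_of n a b. x i = a i \<and> y i = b i \<and> E x = E y"
proof (rule ccontr)
  assume neg: "\<not> ?thesis"
  let ?Q = "box_of n a b"
  have "topspace (subtopology (Euclidean_space n) ?Q) = ?Q"
    by (auto simp: rectangle_def)
  then have contE: "continuous_on ?Q E" and EQ: "E ` ?Q \<subseteq> topspace (Euclidean_space d)"
    using E unfolding continuous_encoder_def cm_Euclidean_space_iff_continuous_on by auto
  define A where "A i = E ` {x \<in> ?Q. x i = a i}" for i
  define A' where "A' i = E ` {x \<in> ?Q. x i = b i}" for i
  have face: "compact {x \<in> ?Q. x i = c}" for i c
  proof -
    have "closed {x::nat \<Rightarrow> real. x i = c}"
      by (intro closed_Collect_eq continuous_on_product_coordinates continuous_on_const)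
    moreover have "{x \<in> ?Q. x i = c} = ?Q \<inter> {x. x i = c}"
      by auto
    ultimately show ?thesis
      using compact_Int_closed[OF compact_box] by metis
  qed
  have comp: "compact (A i)" "compact (A' i)" for i
    unfolding A_def A'_def
    by (intro compact_continuous_image face continuous_on_subset[OF contE]; auto)+
  have ne: "A i \<noteq> {}" "A' i \<noteq> {}" if "i < n" for i
  proof -
    have "(\<lambda>j. if j < n then a j else 0) \<in> {x \<in> ?Q. x i = a i}"
      "(\<lambda>j. if j < n then b j else 0) \<in> {x \<in> ?Q. x i = b i}"
      using that ab by (auto simp: rectangle_def topspace_Euclidean_space)
    then show "A i \<noteq> {}" "A' i \<noteq> {}"
      unfolding A_def A'_def by blast+
  qed
  have disj: "A i \<inter> A' i = {}" if "i < n" for i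
    using neg that unfolding A_def A'_def by fastforce
  define h where "h i z = infdist z (A i) - infdist z (A' i)" for i z
  have gap: "\<exists>\<delta>>0. (\<forall>z\<in>A i. h i z \<le> - \<delta>) \<and> (\<forall>z\<in>A' i. \<delta> \<le> h i z)" if i: "i < n" for i
  proof -
    have "continuous_on X (h i)" for X
      unfolding h_def by (intro continuous_intros)
    then obtain z w where z: "z \<in> A i" "\<And>z'. z' \<in> A i \<Longrightarrow> h i z' \<le> h i z"
      and w: "w \<in> A' i" "\<And>w'. w' \<in> A' i \<Longrightarrow> h i w \<le> h i w'"
      using continuous_attains_sup[OF comp(1)[of i], of "h i"] ne[OF i]
        continuous_attains_inf[OF comp(2)[of i], of "h i"] by metis
    have "h i z < 0" "0 < h i w"
      using z(1) w(1) disj[OF i] ne[OF i] comp[of i, THEN compact_imp_closed]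
      by (auto simp: h_def intro!: infdist_pos_not_in_closed)
    then show ?thesis
      using z(2) w(2) by (intro exI[of _ "min (- h i z) (h i w)"]) (force)
  qed
  then obtain D where D: "\<And>i. i < n \<Longrightarrow> 0 < D i" "\<And>i z. i < n \<Longrightarrow> z \<in> A i \<Longrightarrow> h i z \<le> - D i"
    "\<And>i z. i < n \<Longrightarrow> z \<in> A' i \<Longrightarrow> D i \<le> h i z"
    by metis
  define \<delta> where "\<delta> = Min (insert 1 (D ` {..<n}))"
  have \<delta>: "0 < \<delta>" "\<And>i. i < n \<Longrightarrow> \<delta> \<le> D i"
    using D(1) by (auto simp: \<delta>_def)
  have "\<exists>M. \<forall>z\<in>E ` ?Q. \<bar>z j\<bar> \<le> M" for j
  proof -
    have "compact ((\<lambda>z. z j) ` E ` ?Q)"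
      using contE compact_box
      by (intro compact_continuous_image continuous_on_subset[OF continuous_on_product_coordinates]) auto
    then have "bounded ((\<lambda>z. z j) ` E ` ?Q)"
      by (rule compact_imp_bounded)
    then show ?thesis
      unfolding bounded_iff by auto
  qed
  then obtain M where M: "\<And>j z. z \<in> E ` ?Q \<Longrightarrow> \<bar>z j\<bar> \<le> M j"
    by metis
  have bound: "\<bar>z j\<bar> \<le> (\<Sum>j<d. \<bar>M j\<bar>)" if "z \<in> E ` ?Q" "j < d" for z j
  proof -
    have "\<bar>M j\<bar> \<le> (\<Sum>j<d. \<bar>M j\<bar>)"
      using \<open>j < d\<close> by (intro member_le_sum) auto
    with M[OF that(1), of j] show ?thesis by linarith
  qed
  have lip: "\<bar>h i z - h i w\<bar> \<le> 2 * dist z w" for i z w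
    using infdist_triangle_abs[of z "A i" w] infdist_triangle_abs[of z "A' i" w]
    unfolding h_def by linarith
  obtain v where v: "\<forall>i<n. \<bar>v i\<bar> \<le> \<delta>" "\<forall>z\<in>E ` ?Q. \<exists>i<n. h i z \<noteq> v i"
    using lipschitz_image_omits_point_of_cube[of "E ` ?Q" d "\<Sum>j<d. \<bar>M j\<bar>" n h 2 \<delta>]
      EQ bound lip \<delta>(1) \<open>d < n\<close> by auto
  have "\<exists>x\<in>?Q. \<forall>i<n. h i (E x) - v i = 0"
  proof (rule poincare_miranda[OF ab])
    fix i assume i: "i < n"
    show "continuous_on ?Q (\<lambda>x. h i (E x) - v i)"
      unfolding h_def by (intro continuous_intros contE)
    fix x assume x: "x \<in> ?Q"
    { assume "x i = a i"
      then have "h i (E x) \<le> - D i"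
        using D(2)[OF i] x by (auto simp: A_def)
      then show "h i (E x) - v i \<le> 0"
        using v(1) \<delta>(2)[OF i] i by (smt (verit)) }
    { assume "x i = b i"
      then have "D i \<le> h i (E x)"
        using D(3)[OF i] x by (auto simp: A'_def)
      then show "0 \<le> h i (E x) - v i"
        using v(1) \<delta>(2)[OF i] i by (smt (verit)) }
  qed
  with v(2) show False
    by fastforce
qed

section \<open>The recovery error on boxes\<close>

text \<open>Whatever a decoder assigns to the common code of two points on opposite faces, it is at least
  half the least side of the box away from one of them.\<close>
lemma recovery_error_ge_half_width:
  assumes width: "\<And>i. i < n \<Longrightarrow> 2 * w \<le> b i - a i" and "0 \<le> w"
    and E: "continuous_encoder n (box_of n a b) d E" and "d < n"
  shows "ereal w \<le> recovery_error n (box_of n a b) E D"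
proof -
  have "a i \<le> b i" if "i < n" for i
    using width[OF that] \<open>0 \<le> w\<close> by linarith
  then obtain i x y where "i < n" and xy: "x \<in> box_of n a b" "y \<in> box_of n a b"
    and i: "x i = a i" "y i = b i" and "E x = E y"
    using continuous_map_identifies_opposite_faces[OF _ E \<open>d < n\<close>] by blast
  have "\<bar>D (E z) i - z i\<bar> \<le> sup_dist n (D (E z)) z" for z
    unfolding sup_dist_def using \<open>i < n\<close> by (intro Max_ge) auto
  from this[of x] this[of y] have "w \<le> sup_dist n (D (E x)) x \<or> w \<le> sup_dist n (D (E y)) y"
    using width[OF \<open>i < n\<close>] i \<open>E x = E y\<close> by (smt (verit))
  then show ?thesis
    unfolding recovery_error_def using xy by (auto intro: SUP_upper2)
qed

lemma sup_dist_self: "0 < n \<Longrightarrow> sup_dist n x x = 0"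
  by (simp add: sup_dist_def image_constant_conv lessThan_empty_iff)

lemma recovery_error_exact:
  assumes "0 < n" "\<And>x. x \<in> X \<Longrightarrow> D (E x) = x"
  shows "recovery_error n X E D \<le> 0"
  unfolding recovery_error_def using assms by (auto intro!: SUP_least simp: sup_dist_self zero_ereal_def)

lemma recovery_error_mono:
  "X \<subseteq> Y \<Longrightarrow> recovery_error n X E D \<le> recovery_error n Y E D"
  unfolding recovery_error_def by (rule SUP_subset_mono) auto

lemma continuous_encoder_subset:
  "continuous_encoder n Y d E \<Longrightarrow> X \<subseteq> Y \<Longrightarrow> continuous_encoder n X d E"
  unfolding continuous_encoder_def by (rule continuous_map_from_subtopology_mono)

lemma scale_set_box:
  assumes "0 < r"
  shows "scale_set r (box_of n a b) = box_of n (\<lambda>i. r * a i) (\<lambda>i. r * b i)"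
proof (intro equalityI subsetI)
  fix x assume "x \<in> box_of n (\<lambda>i. r * a i) (\<lambda>i. r * b i)"
  then have "(\<lambda>i. x i / r) \<in> box_of n a b"
    using assms by (auto simp: rectangle_def topspace_Euclidean_space field_simps)
  then show "x \<in> scale_set r (box_of n a b)"
    unfolding scale_set_def using assms by (intro image_eqI[where x = "\<lambda>i. x i / r"]) auto
qed (use assms in \<open>auto simp: scale_set_def rectangle_def topspace_Euclidean_space\<close>)

lemma value_cube_eq_box:
  "value_cube t = box_of (t + 2) (\<lambda>i. if i = 0 then 1/2 else -1/8) (\<lambda>i. if i = 0 then 3/4 else 1/8)"
  (is "_ = ?B")
proof (intro equalityI subsetI)
  fix x assume x: "x \<in> ?B"
  let ?v = "\<lambda>i. x i - (if i = 0 then 5/8 else 0)"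
  have "?v \<in> rectangle (t + 2) (\<lambda>i. {-1/8..1/8})"
    using x by (auto simp: rectangle_def topspace_Euclidean_space)
  then show "x \<in> value_cube t"
    unfolding value_cube_def by (intro image_eqI[where x = ?v]) auto
qed (auto simp: value_cube_def rectangle_def topspace_Euclidean_space)

lemma scaled_value_cube_recovery_error:
  assumes "0 < r" "continuous_encoder (t + 2) (scale_set r (value_cube t)) d E" "d < t + 2"
  shows "ereal (r/8) \<le> recovery_error (t + 2) (scale_set r (value_cube t)) E D"
  using assms unfolding value_cube_eq_box scale_set_box[OF assms(1)]
  by (intro recovery_error_ge_half_width) auto

lemma value_cube_recovery_error:
  assumes "continuous_encoder (t + 2) (value_cube t) d E" "d < t + 2"
  shows "ereal (1/8) \<le> recovery_error (t + 2) (value_cube t) E D"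
  using assms scaled_value_cube_recovery_error[of 1 t d E D] by (simp add: scale_set_def)

section \<open>A subtree with independent vintage values\<close>

text \<open>There is one outcome for each vintage, and vintage \<open>s\<close> is certain that outcome \<open>s\<close> occurs,
  whatever the action. The terminal rewards of an action thus set all its vintage values
  independently. Action 0 is the one to be chosen and action 1 the alternative that only vintage 0
  would have liked to commit to.\<close>
definition vintage_tree :: "real \<Rightarrow> nat \<Rightarrow> (nat, nat) subtree" where
  "vintage_tree M t =
     \<lparr>date = t, actions = {0, 1}, outcomes = (\<lambda>a. {0..t}), discount = 1,
      current_bound = M, terminal_bound = M, kernels = (\<lambda>s a. {indicator {s}})\<rparr>"

lemma vintage_tree_simps [simp]:
  "date (vintage_tree M t) = t" "actions (vintage_tree M t) = {0, 1}"
  "outcomes (vintage_tree M t) a = {0..t}" "discount (vintage_tree M t) = 1"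
  "current_bound (vintage_tree M t) = M" "terminal_bound (vintage_tree M t) = M"
  "kernels (vintage_tree M t) s a = {indicator {s}}"
  "scale_bounds r (vintage_tree M t) = vintage_tree (r * M) t"
  by (simp_all add: vintage_tree_def scale_bounds_def)

lemma one_decision_subtree_vintage_tree: "0 \<le> M \<Longrightarrow> one_decision_subtree (vintage_tree M t)"
  by (auto simp: one_decision_subtree_def prob_simplex_def indicator_def)

lemma vintage_value_vintage_tree:
  "s \<le> t \<Longrightarrow> vintage_value (vintage_tree M t) c g s a = c a + g a s"
  by (simp add: vintage_value_def indicator_def if_distrib[of "\<lambda>x. x * _"] cong: if_cong)

text \<open>Action 0 pays the prescribed values. Action 1 pays vintage 0 the prescribed precommitment value
  \<open>x 0\<close>, which is the maximum since \<open>x 1 \<le> x 0\<close>, and pays everyone else the lowest reward, so that the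
  current vintage \<open>t\<close> accepts action 0. Here \<open>t \<ge> 1\<close> makes the current vintage different from
  vintage 0.\<close>
lemma attainable_vintage_tree:
  assumes "1 \<le> t" and x: "x \<in> topspace (Euclidean_space (t + 2))"
    and bound: "\<And>i. i < t + 2 \<Longrightarrow> \<bar>x i\<bar> \<le> M" and "x 1 \<le> x 0"
  shows "x \<in> attainable (vintage_tree M t)"
proof -
  let ?S = "vintage_tree M t"
  define g where "g a y = (if a = (0::nat) then x (y + 1) else if y = 0 then x 0 else - M)" for a y
  have "0 \<le> M"
    using bound[of 0] by simp
  then have "bounded_rewards ?S (\<lambda>_. 0) g"
    using bound by (auto simp: bounded_rewards_def g_def abs_le_iff minus_le_iff)
  moreover have "is_arg_max (vintage_value ?S (\<lambda>_. 0) g (date ?S)) (\<lambda>a. a \<in> actions ?S) 0"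
    using \<open>1 \<le> t\<close> bound[of "t + 1"]
    by (auto simp: is_arg_max_def vintage_value_vintage_tree g_def)
  moreover have "value_vector ?S (\<lambda>_. 0) g 0 = x"
  proof
    fix i
    show "value_vector ?S (\<lambda>_. 0) g 0 i = x i"
      using x \<open>x 1 \<le> x 0\<close>
      by (auto simp: value_vector_def vintage_value_vintage_tree g_def topspace_Euclidean_space)
  qed
  ultimately show ?thesis
    unfolding attainable_def by (smt (verit) mem_Collect_eq)
qed

lemma scaled_box_attainable:
  assumes "1 \<le> t" "0 < r"
  shows "scale_set r (rectangle (t + 2) (\<lambda>i. if i = 0 then {1/2..3/4} else {-1/4..1/4}))
         \<subseteq> attainable (vintage_tree r t)"
proof -
  have "(\<lambda>i. r * x i) \<in> attainable (vintage_tree r t)"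
    if x: "x \<in> rectangle (t + 2) (\<lambda>i. if i = 0 then {1/2..3/4} else {-1/4..1/4})" for x
  proof (rule attainable_vintage_tree[OF \<open>1 \<le> t\<close>])
    have coord: "x i \<in> (if i = 0 then {1/2..3/4} else {-1/4..1/4})" if "i < t + 2" for i
      using x that by (simp add: rectangle_def)
    show "(\<lambda>i. r * x i) \<in> topspace (Euclidean_space (t + 2))"
      using x by (auto simp: rectangle_def topspace_Euclidean_space)
    show "\<bar>r * x i\<bar> \<le> r" if "i < t + 2" for i
      using coord[OF that] \<open>0 < r\<close> by (auto simp: abs_mult split: if_splits)
    show "r * x 1 \<le> r * x 0"
      using coord[of 0] coord[of 1] \<open>0 < r\<close> by auto
  qed
  then show ?thesis
    by (auto simp: scale_set_def)
qed

lemma value_cube_subset: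
  "value_cube t \<subseteq> rectangle (t + 2) (\<lambda>i. if i = 0 then {1/2..3/4} else {-1/4..1/4})"
  unfolding value_cube_eq_box by (fastforce simp: rectangle_def)

section \<open>Memory dimension\<close>

lemma sufficient_memory_full:
  assumes "0 < n" "0 \<le> \<epsilon>"
  shows "sufficient_memory \<epsilon> n X n"
proof -
  have "continuous_encoder n X n (\<lambda>x. x)" "decoder n n (\<lambda>x. x)"
    by (auto simp: continuous_encoder_def decoder_def continuous_map_from_subtopology)
  moreover have "recovery_error n X (\<lambda>x. x) (\<lambda>x. x) \<le> ereal \<epsilon>"
    using recovery_error_exact[of n X "\<lambda>x. x" "\<lambda>x. x"] assms by (simp add: order_trans)
  ultimately show ?thesis
    unfolding sufficient_memory_def by blast
qed

text \<open>This bound makes the supremum in the worst-case dimension a supremum of a bounded set of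
  natural numbers. For an unbounded set it would be an unspecified number.\<close>
lemma memory_dim_le: "0 < n \<Longrightarrow> 0 \<le> \<epsilon> \<Longrightarrow> memory_dim \<epsilon> n X \<le> n"
  unfolding memory_dim_def by (rule Least_le) (rule sufficient_memory_full)

lemma memory_dim_ge:
  assumes "0 \<le> \<epsilon>" "\<epsilon> < 1/8" "value_cube t \<subseteq> X"
  shows "t + 2 \<le> memory_dim \<epsilon> (t + 2) X"
proof -
  have "sufficient_memory \<epsilon> (t + 2) X (memory_dim \<epsilon> (t + 2) X)"
    unfolding memory_dim_def using assms by (intro LeastI) (rule sufficient_memory_full, auto)
  then obtain E D where E: "continuous_encoder (t + 2) X (memory_dim \<epsilon> (t + 2) X) E"
    and err: "recovery_error (t + 2) X E D \<le> ereal \<epsilon>"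
    unfolding sufficient_memory_def by blast
  have "recovery_error (t + 2) (value_cube t) E D \<le> ereal \<epsilon>"
    using recovery_error_mono[OF assms(3)] err by (rule order_trans)
  also have "\<dots> < ereal (1/8)"
    using assms by simp
  finally have "\<not> ereal (1/8) \<le> recovery_error (t + 2) (value_cube t) E D"
    by simp
  then show ?thesis
    using value_cube_recovery_error[OF continuous_encoder_subset[OF E assms(3)]] by (meson not_le)
qed

lemma worst_case_dim_ge:
  assumes "0 \<le> \<epsilon>" "\<epsilon> < 1/8" "1 \<le> t"
  shows "t + 2 \<le> worst_case_dim \<epsilon> 1 1 t"
proof -
  have "value_cube t \<subseteq> attainable (vintage_tree 1 t)"
    using scaled_box_attainable[OF \<open>1 \<le> t\<close>, of 1] value_cube_subset[of t] by (simp add: scale_set_def)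
  then have "t + 2 \<le> memory_dim \<epsilon> (t + 2) (attainable (vintage_tree 1 t))"
    using assms by (intro memory_dim_ge)
  also have "\<dots> \<le> worst_case_dim \<epsilon> 1 1 t"
    unfolding worst_case_dim_def
  proof (rule cSUP_upper)
    show "bdd_above ((\<lambda>S. memory_dim \<epsilon> (t + 2) (attainable S)) `
        {S :: (nat, nat) subtree. one_decision_subtree S \<and> date S = t \<and>
           current_bound S = 1 \<and> terminal_bound S = 1})"
      using memory_dim_le[of "t + 2" \<epsilon>] assms by (intro bdd_aboveI[of _ "t + 2"]) auto
  qed (simp add: one_decision_subtree_vintage_tree)
  finally show ?thesis .
qed

theorem theorem7p5:
  "(\<forall>t\<ge>1.
      (\<exists>S :: (nat, nat) subtree. one_decision_subtree S \<and> date S = t \<and>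
         rectangle (t + 2) (\<lambda>i. if i = 0 then {1/2<..<3/4} else {-1/4<..<1/4}) \<subseteq> attainable S \<and>
         rectangle (t + 2) (\<lambda>i. if i = 0 then {1/2..3/4} else {-1/4..1/4}) \<subseteq> attainable S \<and>
         value_cube t \<subseteq> attainable S \<and>
         (\<forall>r>0. scale_set r (value_cube t) \<subseteq> attainable (scale_bounds r S))) \<and>
      (\<forall>d E D. continuous_encoder (t + 2) (value_cube t) d E \<longrightarrow> decoder d (t + 2) D \<longrightarrow>
         (d < t + 2 \<longrightarrow> recovery_error (t + 2) (value_cube t) E D \<ge> ereal (1/8)) \<and>
         ((\<forall>x\<in>value_cube t. D (E x) = x) \<longrightarrow> d \<ge> t + 2) \<and>
         (recovery_error (t + 2) (value_cube t) E D < ereal (1/8) \<longrightarrow> d \<ge> t + 2)) \<and>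
      (\<forall>r>0. \<forall>d E D.
         continuous_encoder (t + 2) (scale_set r (value_cube t)) d E \<longrightarrow> decoder d (t + 2) D \<longrightarrow>
         d < t + 2 \<longrightarrow>
         recovery_error (t + 2) (scale_set r (value_cube t)) E D \<ge> ereal (r/8))) \<and>
   (\<exists>R G. 0 \<le> R \<and> 0 \<le> G \<and>
      (\<forall>\<epsilon>. 0 \<le> \<epsilon> \<and> \<epsilon> < 1/8 \<longrightarrow>
         (\<lambda>t. real (worst_case_dim \<epsilon> R G t)) \<in> \<Omega>(\<lambda>t. real t)))"
proof (intro conjI allI impI)
  fix t :: nat assume t: "1 \<le> t"
  let ?R = "rectangle (t + 2) (\<lambda>i. if i = 0 then {1/2..3/4::real} else {-1/4..1/4})"
  have R: "?R \<subseteq> attainable (vintage_tree 1 t)"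
    using scaled_box_attainable[OF t, of 1] by (simp add: scale_set_def)
  have "rectangle (t + 2) (\<lambda>i. if i = 0 then {1/2<..<3/4} else {-1/4<..<1/4}) \<subseteq> ?R"
    by (fastforce simp: rectangle_def)
  moreover have "scale_set r (value_cube t) \<subseteq> attainable (scale_bounds r (vintage_tree 1 t))"
    if "0 < r" for r
    using scaled_box_attainable[OF t that] value_cube_subset[of t] by (auto simp: scale_set_def)
  ultimately show "\<exists>S :: (nat, nat) subtree. one_decision_subtree S \<and> date S = t \<and>
      rectangle (t + 2) (\<lambda>i. if i = 0 then {1/2<..<3/4} else {-1/4<..<1/4}) \<subseteq> attainable S \<and>
      ?R \<subseteq> attainable S \<and> value_cube t \<subseteq> attainable S \<and>
      (\<forall>r>0. scale_set r (value_cube t) \<subseteq> attainable (scale_bounds r S))"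
    using R value_cube_subset[of t] one_decision_subtree_vintage_tree[of 1 t]
    by (intro exI[of _ "vintage_tree 1 t"]) auto
next
  fix t d E D
  assume E: "continuous_encoder (t + 2) (value_cube t) d E"
  show "d < t + 2 \<Longrightarrow> ereal (1/8) \<le> recovery_error (t + 2) (value_cube t) E D"
    by (rule value_cube_recovery_error[OF E])
  then show "recovery_error (t + 2) (value_cube t) E D < ereal (1/8) \<Longrightarrow> t + 2 \<le> d"
    by (meson not_le)
  moreover assume "\<forall>x\<in>value_cube t. D (E x) = x"
  then have "recovery_error (t + 2) (value_cube t) E D \<le> 0"
    by (intro recovery_error_exact) auto
  then have "recovery_error (t + 2) (value_cube t) E D < ereal (1/8)"
    by (rule order_le_less_trans) simp
  ultimately show "t + 2 \<le> d"
    by blast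
next
  show "ereal (r/8) \<le> recovery_error (t + 2) (scale_set r (value_cube t)) E D"
    if "0 < r" "continuous_encoder (t + 2) (scale_set r (value_cube t)) d E" "d < t + 2" for t r d E D
    using that by (rule scaled_value_cube_recovery_error)
next
  have "(\<lambda>t. real (worst_case_dim \<epsilon> 1 1 t)) \<in> \<Omega>(\<lambda>t. real t)" if "0 \<le> \<epsilon>" "\<epsilon> < 1/8" for \<epsilon>
  proof (rule landau_omega.bigI[of 1])
    show "\<forall>\<^sub>F t in sequentially. 1 * norm (real t) \<le> norm (real (worst_case_dim \<epsilon> 1 1 t))"
      using eventually_ge_at_top[of 1]
    proof eventually_elim
      case (elim t)
      then show ?case
        using worst_case_dim_ge[OF that elim] by simp
    qed
  qed simp
  then show "\<exists>R G. 0 \<le> R \<and> 0 \<le> G \<and> (\<forall>\<epsilon>. 0 \<le> \<epsilon> \<and> \<epsilon> < 1/8 \<longrightarrow>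
      (\<lambda>t. real (worst_case_dim \<epsilon> R G t)) \<in> \<Omega>(\<lambda>t. real t))"
    by (intro exI[of _ 1]) auto
qed

end
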